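(* Let $p\in\mathbb{N}$ and $d\ge2$. There exist constants $C,c,C',c'\in(0,\infty)$ depending only on $d$ and $p$ such that for all sufficiently large $k\in\mathbb{N}$ there exists a function $\phi_k:\mathcal{C}_k^{(d)}\to\mathbb{R}$ in $\mathrm{span}\{\mathbf{1}_{\mathcal{S}}:\mathcal{S}\text{ is a length-}p\text{ shuffle class in }\mathcal{C}_k^{(d)}\}$ satisfying $$\|\phi_k-\mathbf{1}\|_1:=\frac{1}{\#\mathcal{C}_k^{(d)}}\sum_{T\in\mathcal{C}_k^{(d)}}|\phi_k(T)-1|\le Ce^{-ck}$$ and $$\|\phi_k-\mathbf{1}\|_\infty:=\sup_{T\in\mathcal{C}_k^{(d)}}|\phi_k(T)-1|\le C'e^{-c'(\log k)^2}.$$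
   Context: A $d$-Catalan tree is a rooted planar tree in which every vertex has $0$ or $d$ children; $\mathcal{C}_k^{(d)}$ is the set of such trees with $k$ internal vertices, and $\mathbf{1}$ is the constant function $1$ on it. For a path $(v_0,\dots,v_p)$ in $T\in\mathcal{C}_k^{(d)}$ ($v_i$ a child of $v_{i-1}$), the siblings of $v_1,\dots,v_p$ subtend $(d-1)p$ subtrees (each sibling with its descendants); the shuffle class $\mathrm{Sh}(T;v_0,\dots,v_p)$ is the set of trees in $\mathcal{C}_k^{(d)}$ obtained from $T$ by rearranging these subtrees among the sibling positions, keeping the rest fixed. A length-$p$ shuffle class is any set of this form and $\mathbf{1}_{\mathcal{S}}$ its indicator. *)

theory Defs
  imports Complex_Main "HOL-Library.Indicator_Function"
begin

text \<open>Rooted planar trees: a vertex is a node with an ordered list of children.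
Vertices are addressed by lists of child indices from the root.\<close>

datatype ptree = Node "ptree list"

primrec kids :: "ptree \<Rightarrow> ptree list" where
  "kids (Node ts) = ts"

definition child :: "ptree \<Rightarrow> nat \<Rightarrow> ptree" where
  "child t i = (if i < length (kids t) then kids t ! i else Node [])"

primrec subt :: "ptree \<Rightarrow> nat list \<Rightarrow> ptree" where
  "subt t [] = t"
| "subt t (i # q) = subt (child t i) q"

primrec is_vertex :: "ptree \<Rightarrow> nat list \<Rightarrow> bool" where
  "is_vertex t [] = True"
| "is_vertex t (i # q) = (i < length (kids t) \<and> is_vertex (child t i) q)"

fun internal :: "ptree \<Rightarrow> nat" where
  "internal (Node ts) = (if ts = [] then 0 else 1 + sum_list (map internal ts))"

fun dcat :: "nat \<Rightarrow> ptree \<Rightarrow> bool" where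
  "dcat d (Node ts) = ((ts = [] \<or> length ts = d) \<and> (\<forall>t\<in>set ts. dcat d t))"

definition Cat :: "nat \<Rightarrow> nat \<Rightarrow> ptree set" where
  "Cat d k = {t. dcat d t \<and> internal t = k}"

text \<open>Grafting: replace the subtree at each address P in S by f P
(addresses in S are assumed pairwise incomparable).\<close>
function graft :: "ptree \<Rightarrow> nat list set \<Rightarrow> (nat list \<Rightarrow> ptree) \<Rightarrow> ptree" where
  "graft (Node ts) S f =
     (if [] \<in> S then f []
      else Node (map (\<lambda>i. graft (ts ! i) {q. i # q \<in> S} (\<lambda>q. f (i # q))) [0..<length ts]))"
  by pat_completeness auto
termination
  by (relation "measure (\<lambda>(t, S, f). size t)")
     (auto simp: less_Suc_eq_le intro!: size_list_estimation' nth_mem)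

text \<open>A path (v_0, ..., v_p) with v_0 at address a and v_i = a @ take i js;
each v_{i-1} must be an internal vertex and js ! (i-1) a valid child index.\<close>
definition is_path :: "ptree \<Rightarrow> nat list \<Rightarrow> nat list \<Rightarrow> bool" where
  "is_path t a js \<longleftrightarrow> is_vertex t a \<and>
     (\<forall>i<length js. js ! i < length (kids (subt t (a @ take i js))))"

definition sibpos :: "ptree \<Rightarrow> nat list \<Rightarrow> nat list \<Rightarrow> nat list set" where
  "sibpos t a js = {a @ take i js @ [j] | i j. i < length js \<and>
      j < length (kids (subt t (a @ take i js))) \<and> j \<noteq> js ! i}"

definition Sh :: "nat \<Rightarrow> nat \<Rightarrow> ptree \<Rightarrow> nat list \<Rightarrow> nat list \<Rightarrow> ptree set" where
  "Sh d k t a js = Cat d k \<inter>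
     {graft t (sibpos t a js) (\<lambda>P. subt t (\<sigma> P)) | \<sigma>.
        bij_betw \<sigma> (sibpos t a js) (sibpos t a js)}"

definition shuffle_classes :: "nat \<Rightarrow> nat \<Rightarrow> nat \<Rightarrow> ptree set set" where
  "shuffle_classes d k p = {Sh d k t a js | t a js.
      t \<in> Cat d k \<and> is_path t a js \<and> length js = p}"

definition in_shuffle_span :: "nat \<Rightarrow> nat \<Rightarrow> nat \<Rightarrow> (ptree \<Rightarrow> real) \<Rightarrow> bool" where
  "in_shuffle_span d k p \<phi> \<longleftrightarrow>
     (\<exists>F c. finite F \<and> F \<subseteq> shuffle_classes d k p \<and>
        (\<forall>T\<in>Cat d k. \<phi> T = (\<Sum>S\<in>F. c S * indicator S T)))"

end

theory Submission
  imports Defs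
begin

text \<open>
  Pick independently at every vertex a uniformly random preferred child and search the tree depth
  first for \<open>p\<close> consecutive preferred edges: follow the preferred path from the root; if it ends
  after fewer than \<open>p\<close> steps, search the subtrees hanging off it one after the other.  Shuffling
  the siblings along the path that is found first changes nothing that was inspected before, so
  for a fixed outcome of the choices the indicator that the search succeeds is a sum of indicators
  of shuffle classes.  Averaging over the choices gives \<open>\<phi>\<close>, and \<open>1 - \<phi>\<close> is the probability that
  the search fails.  A tree with \<open>k\<close> internal vertices contains linearly many disjoint paths of
  length \<open>p\<close>, each of which is preferred with probability \<open>d\<^sup>-\<^sup>p\<close>, so this probability is
  exponentially small in \<open>k\<close>, uniformly over all trees.
\<close>

section \<open>Shuffle classes along a fixed path\<close>

lemma is_vertex_append:
  "is_vertex t (q @ r) \<longleftrightarrow> is_vertex t q \<and> is_vertex (subt t q) r"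
  by (induction q arbitrary: t) auto

lemma subt_append: "subt t (q @ r) = subt (subt t q) r"
  by (induction q arbitrary: t) auto

lemma is_path_Cons:
  "is_path t (i # a) js \<longleftrightarrow> i < length (kids t) \<and> is_path (child t i) a js"
  by (auto simp: is_path_def)

lemma is_path_Nil_Cons:
  "is_path t [] (j # js) \<longleftrightarrow> j < length (kids t) \<and> is_path (child t j) [] js"
  by (auto simp: is_path_def All_less_Suc2)

lemma is_path_vertex_take:
  assumes "is_path t a js" "i \<le> length js"
  shows "is_vertex t (a @ take i js)"
  using assms(2)
proof (induction i)
  case 0
  then show ?case using assms(1) by (simp add: is_path_def)
next
  case (Suc i)
  then show ?case
    using assms(1) by (simp add: is_path_def take_Suc_conv_app_nth is_vertex_append subt_append)
qed

section \<open>Grafting at sets of addresses\<close>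

lemma graft_empty: "graft t {} f = t"
  by (induction t "{} :: nat list set" f rule: graft.induct) (auto intro: nth_equalityI)

lemma graft_root: "[] \<in> S \<Longrightarrow> graft t S f = f []"
  by (cases t) simp

lemma length_kids_graft: "[] \<notin> S \<Longrightarrow> length (kids (graft t S f)) = length (kids t)"
  by (cases t) simp

lemma child_graft:
  "[] \<notin> S \<Longrightarrow> i < length (kids t) \<Longrightarrow>
    child (graft t S f) i = graft (child t i) {q. i # q \<in> S} (\<lambda>q. f (i # q))"
  by (cases t) (simp add: child_def)

lemma graft_graft: "graft (graft t S f) S g = graft t S g"
proof (induction t S f arbitrary: g rule: graft.induct)
  case (1 ts S f)
  then show ?case by (cases "[] \<in> S") (auto simp: graft_root)
qed

lemma graft_cong: "(\<And>q. q \<in> S \<Longrightarrow> f q = g q) \<Longrightarrow> graft t S f = graft t S g"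
proof (induction t S f arbitrary: g rule: graft.induct)
  case (1 ts S f)
  then show ?case by (cases "[] \<in> S") (auto simp: graft_root)
qed

text \<open>The descent to \<open>q\<close> is never cut off, because only proper prefixes of
  \<open>q\<close> are kept out of \<open>S\<close>. The address \<open>q\<close> itself may lie in
  \<open>S\<close>.\<close>

lemma subt_graft:
  assumes "\<And>u v. q = u @ v \<Longrightarrow> v \<noteq> [] \<Longrightarrow> u \<notin> S" "is_vertex t q"
  shows "is_vertex (graft t S f) q \<and>
    subt (graft t S f) q = graft (subt t q) {r. q @ r \<in> S} (\<lambda>r. f (q @ r))"
  using assms
proof (induction q arbitrary: t S f)
  case Nil
  then show ?case by simp
next
  case (Cons i q)
  have S: "[] \<notin> S" using Cons.prems(1)[of "[]" "i # q"] by simp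
  have i: "i < length (kids t)" "is_vertex (child t i) q" using Cons.prems(2) by auto
  have "is_vertex (graft (child t i) {q. i # q \<in> S} (\<lambda>q. f (i # q))) q \<and>
    subt (graft (child t i) {q. i # q \<in> S} (\<lambda>q. f (i # q))) q =
      graft (subt (child t i) q) {r. q @ r \<in> {q. i # q \<in> S}} (\<lambda>r. f (i # q @ r))"
    using Cons.prems(1)[of "i # _"] by (intro Cons.IH i(2)) auto
  then show ?case using S i by (simp add: child_graft length_kids_graft)
qed

text \<open>A sibling position leaves the path at its last index, so it cannot be a prefix of the
  address where the path ends. Hence grafting at sibling positions keeps the path intact.\<close>

lemma sibpos_not_prefix:
  assumes "u @ v = a @ js"
  shows "u \<notin> sibpos t a js"
proof
  assume "u \<in> sibpos t a js"
  then obtain i j where ij: "u = a @ take i js @ [j]" "i < length js" "j \<noteq> js ! i"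
    by (auto simp: sibpos_def)
  with assms have "take i js @ j # v = js" by simp
  then have "js ! i = j" using ij(2)
    by (metis length_take less_imp_le min.absorb2 nth_append_length)
  with ij(3) show False by simp
qed

context
  fixes t a js f t'
  assumes path: "is_path t a js"
  defines "t' \<equiv> graft t (sibpos t a js) f"
begin

lemma subt_graft_path:
  assumes "i \<le> length js"
  shows "is_vertex t' (a @ take i js)"
    and "length (kids (subt t' (a @ take i js))) = length (kids (subt t (a @ take i js)))"
proof -
  let ?q = "a @ take i js"
  have 1: "u \<notin> sibpos t a js" if "?q = u @ v" for u v
    by (rule sibpos_not_prefix[of _ "v @ drop i js"])
       (metis append.assoc append_take_drop_id that)
  have 2: "[] \<notin> {r. ?q @ r \<in> sibpos t a js}" using 1[of ?q "[]"] by simp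
  have "is_vertex t' ?q \<and>
    subt t' ?q = graft (subt t ?q) {r. ?q @ r \<in> sibpos t a js} (\<lambda>r. f (?q @ r))"
    unfolding t'_def by (rule subt_graft) (use 1 is_path_vertex_take[OF path assms] in auto)
  with 2 show "is_vertex t' ?q" "length (kids (subt t' ?q)) = length (kids (subt t ?q))"
    by (auto simp: length_kids_graft simp del: append_assoc)
qed

lemma is_path_graft_sibpos: "is_path t' a js"
  using path subt_graft_path(1)[of 0] subt_graft_path(2) by (auto simp: is_path_def)

lemma sibpos_graft_sibpos: "sibpos t' a js = sibpos t a js"
  unfolding sibpos_def using subt_graft_path(2) by fastforce

lemma subt_graft_sibpos:
  assumes "q \<in> sibpos t a js"
  shows "subt t' q = f q"
proof -
  obtain i j where ij: "q = a @ take i js @ [j]" "i < length js"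
      "j < length (kids (subt t (a @ take i js)))"
    using assms by (auto simp: sibpos_def)
  have "is_vertex t ((a @ take i js) @ [j])"
    using ij is_path_vertex_take[OF path, of i] by (simp only: is_vertex_append[of _ _ "[j]"]) simp
  then have v: "is_vertex t q" using ij by simp
  \<comment> \<open>Proper prefixes of a sibling position lie on the path, so sibling positions are
    pairwise incomparable.\<close>
  have "u \<notin> sibpos t a js" if "q = u @ v" "v \<noteq> []" for u v
  proof -
    have "a @ take i js = u @ butlast v"
      using that ij(1) by (metis append.assoc butlast_append butlast_snoc)
    then have "u @ butlast v @ drop i js = a @ js"
      by (metis append.assoc append_take_drop_id)
    then show ?thesis by (rule sibpos_not_prefix)
  qed
  from subt_graft[OF this v] show ?thesis
    unfolding t'_def using assms by (simp add: graft_root)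
qed

end

lemma Sh_self: "t \<in> Cat d k \<Longrightarrow> is_path t a js \<Longrightarrow> t \<in> Sh d k t a js"
proof -
  assume t: "t \<in> Cat d k" "is_path t a js"
  have "graft t S (\<lambda>q. subt t q) = t" for S
    by (induction t arbitrary: S)
       (auto simp: child_def intro!: nth_equalityI)
  then show ?thesis using t unfolding Sh_def
    by (auto intro!: exI[of _ id])
qed

text \<open>Successive shuffles compose their bijections, and a shuffle is undone by the inverse
  bijection. Together with \<open>Sh_self\<close>, the classes for fixed \<open>a\<close> and
  \<open>js\<close> therefore partition the trees in \<open>Cat d k\<close> that contain this
  path.\<close>

lemma Sh_eq:
  assumes path: "is_path t a js" and t': "t' \<in> Sh d k t a js"
  shows "is_path t' a js" "Sh d k t' a js = Sh d k t a js"
proof -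
  let ?P = "sibpos t a js"
  obtain \<sigma> where \<sigma>: "bij_betw \<sigma> ?P ?P" and t'_eq: "t' = graft t ?P (\<lambda>q. subt t (\<sigma> q))"
    using t' unfolding Sh_def by blast
  show "is_path t' a js" unfolding t'_eq by (rule is_path_graft_sibpos[OF path])
  have P: "sibpos t' a js = ?P" unfolding t'_eq by (rule sibpos_graft_sibpos[OF path])
  have sub: "subt t' q = subt t (\<sigma> q)" if "q \<in> ?P" for q
    unfolding t'_eq by (rule subt_graft_sibpos[OF path that])
  have gr: "graft t' ?P (\<lambda>q. subt t' (\<tau> q)) = graft t ?P (\<lambda>q. subt t ((\<sigma> \<circ> \<tau>) q))"
    if "bij_betw \<tau> ?P ?P" for \<tau>
  proof -
    have "graft t' ?P (\<lambda>q. subt t' (\<tau> q)) = graft t ?P (\<lambda>q. subt t' (\<tau> q))"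
      unfolding t'_eq by (rule graft_graft)
    also have "\<dots> = graft t ?P (\<lambda>q. subt t ((\<sigma> \<circ> \<tau>) q))"
      using that by (intro graft_cong) (auto simp: sub dest: bij_betwE)
    finally show ?thesis .
  qed
  have "{graft t' ?P (\<lambda>q. subt t' (\<tau> q)) |\<tau>. bij_betw \<tau> ?P ?P} =
        {graft t ?P (\<lambda>q. subt t (\<tau> q)) |\<tau>. bij_betw \<tau> ?P ?P}" (is "?L = ?R")
  proof (intro equalityI subsetI)
    fix x assume "x \<in> ?L"
    then obtain \<tau> where "bij_betw \<tau> ?P ?P" "x = graft t' ?P (\<lambda>q. subt t' (\<tau> q))" by blast
    then show "x \<in> ?R" using gr bij_betw_trans[OF _ \<sigma>] by blast
  next
    fix x assume "x \<in> ?R"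
    then obtain \<tau> where \<tau>: "bij_betw \<tau> ?P ?P" "x = graft t ?P (\<lambda>q. subt t (\<tau> q))" by blast
    let ?\<rho> = "the_inv_into ?P \<sigma> \<circ> \<tau>"
    have \<rho>: "bij_betw ?\<rho> ?P ?P"
      using bij_betw_trans[OF \<tau>(1) bij_betw_the_inv_into[OF \<sigma>]] .
    have "\<sigma> (?\<rho> q) = \<tau> q" if "q \<in> ?P" for q
      using f_the_inv_into_f_bij_betw[OF \<sigma>] bij_betwE[OF \<tau>(1)] that by simp
    then have "x = graft t ?P (\<lambda>q. subt t ((\<sigma> \<circ> ?\<rho>) q))"
      unfolding \<tau>(2) by (intro graft_cong) simp
    then have "x = graft t' ?P (\<lambda>q. subt t' (?\<rho> q))" using gr[OF \<rho>] by simp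
    then show "x \<in> ?L" using \<rho> by blast
  qed
  then show "Sh d k t' a js = Sh d k t a js" unfolding Sh_def P by simp
qed

text \<open>This is equality of everything visible before the search enters the subtree at
  \<open>a\<close>. Indices \<open>j\<close> out of range are harmless, since \<open>child\<close>
  returns a leaf there.\<close>

primrec agree_off :: "nat list \<Rightarrow> ptree \<Rightarrow> ptree \<Rightarrow> bool" where
  "agree_off [] t t' = True"
| "agree_off (i # a) t t' \<longleftrightarrow> length (kids t) = length (kids t') \<and>
     (\<forall>j. j \<noteq> i \<longrightarrow> child t j = child t' j) \<and> agree_off a (child t i) (child t' i)"

lemma agree_off_graft:
  assumes "is_vertex t a" "\<And>q. q \<in> S \<Longrightarrow> \<exists>r. q = a @ r"
  shows "agree_off a t (graft t S f)"
  using assms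
proof (induction a arbitrary: t S f)
  case Nil
  then show ?case by simp
next
  case (Cons i a)
  have S: "[] \<notin> S" using Cons.prems(2) by fastforce
  have "child t j = child (graft t S f) j" if "j \<noteq> i" for j
  proof (cases "j < length (kids t)")
    case True
    have "{q. j # q \<in> S} = {}" using Cons.prems(2) that by fastforce
    then show ?thesis using True S by (simp add: child_graft graft_empty)
  next
    case False
    then show ?thesis using S by (simp add: child_def length_kids_graft)
  qed
  moreover have "agree_off a (child t i) (graft (child t i) {q. i # q \<in> S} (\<lambda>q. f (i # q)))"
    using Cons.prems by (intro Cons.IH) fastforce+
  ultimately show ?case using Cons.prems(1) S by (simp add: length_kids_graft child_graft)
qed

lemma agree_off_Sh:
  assumes "is_path t a js" "t' \<in> Sh d k t a js"
  shows "agree_off a t t'"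
proof -
  obtain f where "t' = graft t (sibpos t a js) f" using assms(2) unfolding Sh_def by blast
  then show ?thesis using assms(1)
    by (auto simp: is_path_def sibpos_def intro!: agree_off_graft)
qed

section \<open>Functions in the span of the shuffle classes\<close>

text \<open>A shuffle along the path preserves the path and everything outside the subtree at
  \<open>a\<close>. Such a \<open>g\<close> is thus constant on each shuffle class along this path
  and zero off their union.\<close>

definition path_local :: "nat list \<Rightarrow> nat list \<Rightarrow> (ptree \<Rightarrow> real) \<Rightarrow> bool" where
  "path_local a js g \<longleftrightarrow> (\<forall>t. \<not> is_path t a js \<longrightarrow> g t = 0) \<and>
     (\<forall>t t'. is_path t a js \<longrightarrow> is_path t' a js \<longrightarrow> agree_off a t t' \<longrightarrow> g t = g t')"

text \<open>Unlike \<^const>\<open>in_shuffle_span\<close>, the following notion does not fix the number of internal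
vertices, which makes it stable under passing from subtrees to trees.\<close>

inductive path_span :: "nat \<Rightarrow> nat \<Rightarrow> (ptree \<Rightarrow> real) \<Rightarrow> bool" for d p where
  zero: "path_span d p (\<lambda>_. 0)"
| path_local: "length js = p \<Longrightarrow> path_local a js g \<Longrightarrow> path_span d p g"
| add: "path_span d p f \<Longrightarrow> path_span d p g \<Longrightarrow> path_span d p (\<lambda>t. f t + g t)"
| cong: "path_span d p f \<Longrightarrow> (\<And>t. dcat d t \<Longrightarrow> f t = g t) \<Longrightarrow> path_span d p g"

lemma path_span_sum:
  "(\<And>i. i \<in> I \<Longrightarrow> path_span d p (f i)) \<Longrightarrow> path_span d p (\<lambda>t. \<Sum>i\<in>I. f i t)"
  by (induction I rule: infinite_finite_induct) (auto intro: path_span.zero path_span.add)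

lemma path_span_cmult: "path_span d p f \<Longrightarrow> path_span d p (\<lambda>t. c * f t)"
proof (induction rule: path_span.induct)
  case zero
  then show ?case by (simp add: path_span.zero)
next
  case (path_local js a g)
  then show ?case by (intro path_span.path_local[of js p a]) (auto simp: path_local_def)
next
  case (add f g)
  then show ?case using path_span.add[OF add.IH] by (simp add: distrib_left)
next
  case (cong f g)
  then show ?case by (intro path_span.cong[OF cong.IH]) simp
qed

lemma dcat_child: "dcat d t \<Longrightarrow> dcat d (child t i)"
  by (cases t) (auto simp: child_def)

lemma dcat_length_kids: "dcat d t \<Longrightarrow> length (kids t) = 0 \<or> length (kids t) = d"
  by (cases t) auto

text \<open>Addresses get the prefix \<open>j\<close>. The weight \<open>h\<close> may inspect
  everything except child \<open>j\<close>, so shuffles inside that child leave it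
  unchanged.\<close>

lemma path_span_child:
  assumes "path_span d p f"
    and h: "\<And>t t'. length (kids t) = length (kids t') \<Longrightarrow>
      (\<And>i. i \<noteq> j \<Longrightarrow> child t i = child t' i) \<Longrightarrow> h t = h t'"
  shows "path_span d p (\<lambda>t. if j < length (kids t) then h t * f (child t j) else 0)"
  using assms(1)
proof (induction rule: path_span.induct)
  case zero
  then show ?case by (rule path_span.cong[OF path_span.zero]) simp
next
  case (path_local js a g)
  let ?g = "\<lambda>t. if j < length (kids t) then h t * g (child t j) else 0"
  have "path_local (j # a) js ?g"
    unfolding path_local_def
  proof (intro conjI allI impI)
    fix t assume "\<not> is_path t (j # a) js"
    then show "?g t = 0" using path_local(2) by (auto simp: is_path_Cons path_local_def)
  next
    fix t t' assume *: "is_path t (j # a) js" "is_path t' (j # a) js" "agree_off (j # a) t t'"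
    have "g (child t j) = g (child t' j)"
      using * path_local(2) unfolding path_local_def is_path_Cons by simp
    moreover have "h t = h t'" using * by (intro h) auto
    ultimately show "?g t = ?g t'" using * by simp
  qed
  then show ?case using path_local(1) by (rule path_span.path_local[rotated])
next
  case (add f g)
  show ?case by (rule path_span.cong[OF path_span.add[OF add.IH]]) (simp add: distrib_left)
next
  case (cong f g)
  then show ?case by (intro path_span.cong[OF cong.IH]) (simp add: dcat_child)
qed

section \<open>Passage from \<open>path_span\<close> to the span of the shuffle classes\<close>

text \<open>Bounding the number of internal vertices, rather than fixing it, lets one induction
  hypothesis cover all children of the root.\<close>

lemma finite_dcat_le:
  assumes "d \<ge> 1"
  shows "finite {t. dcat d t \<and> internal t \<le> n}"
proof (induction n)
  case 0
  have "{t. dcat d t \<and> internal t \<le> 0} \<subseteq> {Node []}"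
  proof
    fix t assume "t \<in> {t. dcat d t \<and> internal t \<le> 0}"
    then show "t \<in> {Node []}" by (cases t) (auto split: if_splits)
  qed
  then show ?case by (rule finite_subset) simp
next
  case (Suc n)
  let ?X = "{t. dcat d t \<and> internal t \<le> n}"
  have "{t. dcat d t \<and> internal t \<le> Suc n} \<subseteq>
    insert (Node []) (Node ` {ts. set ts \<subseteq> ?X \<and> length ts = d})"
  proof
    fix t assume t: "t \<in> {t. dcat d t \<and> internal t \<le> Suc n}"
    show "t \<in> insert (Node []) (Node ` {ts. set ts \<subseteq> ?X \<and> length ts = d})"
    proof (cases t)
      case (Node ts)
      have "internal s \<le> n" if "s \<in> set ts" for s
      proof -
        have "internal s \<le> sum_list (map internal ts)" using that by (simp add: member_le_sum_list)
        then show ?thesis using t Node that by (auto split: if_splits)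
      qed
      then show ?thesis using t Node by auto
    qed
  qed
  then show ?case by (rule finite_subset) (simp add: finite_lists_length_eq Suc.IH)
qed

lemma finite_Cat: "d \<ge> 1 \<Longrightarrow> finite (Cat d k)"
  by (rule finite_subset[OF _ finite_dcat_le[of d k]]) (auto simp: Cat_def)

text \<open>Each tree containing the path lies in exactly one class, and \<open>g\<close> is
  constant there; its value at a chosen representative serves as the coefficient.\<close>

lemma in_shuffle_span_path_local:
  assumes "d \<ge> 1" "length js = p" and g: "path_local a js g"
  shows "in_shuffle_span d k p g"
proof -
  let ?D = "{t \<in> Cat d k. is_path t a js}"
  let ?F = "(\<lambda>t. Sh d k t a js) ` ?D"
  define rep where "rep S = (SOME t. t \<in> ?D \<and> Sh d k t a js = S)" for S
  have rep: "rep S \<in> ?D \<and> Sh d k (rep S) a js = S" if "S \<in> ?F" for S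
    unfolding rep_def by (rule someI_ex) (use that in blast)
  have fin: "finite ?F" using finite_Cat[OF assms(1)] by simp
  have "g t = (\<Sum>S\<in>?F. g (rep S) * indicator S t)" if t: "t \<in> Cat d k" for t
  proof (cases "is_path t a js")
    case True
    let ?S = "Sh d k t a js"
    have S: "?S \<in> ?F" using t True by blast
    have "S = ?S" if "S \<in> ?F" "t \<in> S" for S
      using rep[OF that(1)] Sh_eq(2)[of "rep S" a js t d k] that(2) by auto
    then have "(\<Sum>S\<in>?F. g (rep S) * indicator S t) = (\<Sum>S\<in>{?S}. g (rep S) * indicator S t)"
      using S fin by (intro sum.mono_neutral_right) (auto simp: indicator_def)
    also have "\<dots> = g (rep ?S)" using Sh_self[OF t True] by simp
    also have "\<dots> = g t"
    proof -
      have "t \<in> Sh d k (rep ?S) a js" using rep[OF S] Sh_self[OF t True] by simp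
      then have "agree_off a (rep ?S) t" using rep[OF S] agree_off_Sh by blast
      then show ?thesis using g rep[OF S] True unfolding path_local_def by blast
    qed
    finally show ?thesis by simp
  next
    case False
    then have "t \<notin> S" if "S \<in> ?F" for S using that Sh_eq(1) by blast
    then have "(\<Sum>S\<in>?F. g (rep S) * indicator S t) = 0" by (intro sum.neutral) simp
    then show ?thesis using g False by (simp add: path_local_def)
  qed
  moreover have "?F \<subseteq> shuffle_classes d k p"
    using assms(2) unfolding shuffle_classes_def by blast
  ultimately show ?thesis using fin unfolding in_shuffle_span_def
    by (intro exI[of _ ?F] exI[of _ "\<lambda>S. g (rep S)"]) blast
qed

lemma in_shuffle_span_add:
  assumes "in_shuffle_span d k p f" "in_shuffle_span d k p g"
  shows "in_shuffle_span d k p (\<lambda>t. f t + g t)"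
proof -
  obtain F c where F: "finite F" "F \<subseteq> shuffle_classes d k p"
      "\<And>t. t \<in> Cat d k \<Longrightarrow> f t = (\<Sum>S\<in>F. c S * indicator S t)"
    using assms(1) unfolding in_shuffle_span_def by blast
  obtain G b where G: "finite G" "G \<subseteq> shuffle_classes d k p"
      "\<And>t. t \<in> Cat d k \<Longrightarrow> g t = (\<Sum>S\<in>G. b S * indicator S t)"
    using assms(2) unfolding in_shuffle_span_def by blast
  let ?e = "\<lambda>S. (if S \<in> F then c S else 0) + (if S \<in> G then b S else 0)"
  have "f t + g t = (\<Sum>S\<in>F \<union> G. ?e S * indicator S t)" if "t \<in> Cat d k" for t
  proof -
    have "f t = (\<Sum>S\<in>F \<union> G. (if S \<in> F then c S else 0) * indicator S t)"
      unfolding F(3)[OF that] using F(1) G(1) by (intro sum.mono_neutral_cong_left) auto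
    moreover have "g t = (\<Sum>S\<in>F \<union> G. (if S \<in> G then b S else 0) * indicator S t)"
      unfolding G(3)[OF that] using F(1) G(1) by (intro sum.mono_neutral_cong_left) auto
    ultimately show ?thesis by (simp add: distrib_right sum.distrib)
  qed
  then show ?thesis using F(1,2) G(1,2) unfolding in_shuffle_span_def
    by (intro exI[of _ "F \<union> G"] exI[of _ ?e]) simp
qed

lemma in_shuffle_span_path_span:
  assumes "d \<ge> 1" "path_span d p f"
  shows "in_shuffle_span d k p f"
  using assms(2)
proof (induction rule: path_span.induct)
  case zero
  then show ?case unfolding in_shuffle_span_def by (intro exI[of _ "{}"]) simp
next
  case (path_local js a g)
  then show ?case using in_shuffle_span_path_local[OF assms(1)] by blast
next
  case (add f g)
  then show ?case by (intro in_shuffle_span_add)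
next
  case (cong f g)
  then show ?case unfolding in_shuffle_span_def by (simp add: Cat_def)
qed

section \<open>The failure probability of the search\<close>

text \<open>The probability that fewer than \<open>r\<close> preferred edges follow each other from the root and that
the search fails in all subtrees hanging off the preferred path, if \<open>E\<close> is the probability that it
fails in a single hanging subtree.\<close>

fun spine_fail :: "nat \<Rightarrow> (ptree \<Rightarrow> real) \<Rightarrow> nat \<Rightarrow> ptree \<Rightarrow> real" where
  "spine_fail d E 0 t = 0"
| "spine_fail d E (Suc r) t = (if kids t = [] then 1 else
     (\<Sum>i<d. spine_fail d E r (child t i) * (\<Prod>j\<in>{..<d} - {i}. E (child t j))) / real d)"

text \<open>The recursion into hanging subtrees is cut off at depth \<open>n\<close>, where the search is declared to
have failed; \<open>n\<close> exceeding the number of internal vertices makes this harmless.\<close>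

primrec search_fail :: "nat \<Rightarrow> nat \<Rightarrow> nat \<Rightarrow> ptree \<Rightarrow> real" where
  "search_fail d p 0 = (\<lambda>_. 1)"
| "search_fail d p (Suc n) = spine_fail d (search_fail d p n) p"

text \<open>With \<open>E = 1\<close> only the preferred path from the root counts. Each index word
  \<open>js\<close> of length \<open>p\<close> is preferred with probability
  \<open>1 / d ^ p\<close>, and at most one word can be the preferred one.\<close>

lemma path_span_root_path: "path_span d p (\<lambda>t. 1 - spine_fail d (\<lambda>_. 1) p t)"
proof -
  let ?W = "{js. set js \<subseteq> {..<d} \<and> length js = p}"
  let ?ind = "\<lambda>js t. if is_path t [] js then 1 else 0 :: real"
  have eq: "1 - spine_fail d (\<lambda>_. 1) r t =
      (\<Sum>js | set js \<subseteq> {..<d} \<and> length js = r. (1 / real d ^ r) * ?ind js t)"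
    if "dcat d t" for r t
    using that
  proof (induction r arbitrary: t)
    case 0
    have "{js. set js \<subseteq> {..<d} \<and> length js = 0} = {[]}" by auto
    then show ?case by (simp add: is_path_def)
  next
    case (Suc r)
    let ?V = "\<lambda>r. {js. set js \<subseteq> {..<d} \<and> length js = r}"
    have V: "?V (Suc r) = (\<lambda>(i, js). i # js) ` ({..<d} \<times> ?V r)"
      by (auto simp: length_Suc_conv image_def)
    have "(\<Sum>js\<in>?V (Suc r). (1 / real d ^ Suc r) * ?ind js t) =
        (\<Sum>(i, js)\<in>{..<d} \<times> ?V r. (1 / real d ^ Suc r) * ?ind (i # js) t)"
      unfolding V by (subst sum.reindex) (auto simp: inj_on_def case_prod_unfold)
    also have "\<dots> = (\<Sum>i<d. \<Sum>js\<in>?V r. (1 / real d ^ Suc r) * ?ind (i # js) t)"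
      by (rule sum.cartesian_product[symmetric])
    also have "\<dots> = 1 - spine_fail d (\<lambda>_. 1) (Suc r) t"
    proof (cases "kids t = []")
      case True
      then show ?thesis by (simp add: is_path_Nil_Cons)
    next
      case False
      then have len: "length (kids t) = d" using dcat_length_kids[OF Suc.prems] by simp
      with False have d: "d > 0" by auto
      have "(\<Sum>js\<in>?V r. (1 / real d ^ Suc r) * ?ind (i # js) t) =
          (1 - spine_fail d (\<lambda>_. 1) r (child t i)) / real d" if "i < d" for i
        unfolding Suc.IH[OF dcat_child[OF Suc.prems]] sum_divide_distrib
        using that len by (intro sum.cong) (auto simp: is_path_Nil_Cons)
      then have "(\<Sum>i<d. \<Sum>js\<in>?V r. (1 / real d ^ Suc r) * ?ind (i # js) t) =
          (\<Sum>i<d. (1 - spine_fail d (\<lambda>_. 1) r (child t i)) / real d)"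
        by (intro sum.cong) auto
      also have "\<dots> = 1 - spine_fail d (\<lambda>_. 1) (Suc r) t"
        using False d by (simp add: sum_divide_distrib[symmetric] sum_subtractf diff_divide_distrib)
      finally show ?thesis .
    qed
    finally show ?case by simp
  qed
  have "path_span d p (\<lambda>t. (1 / real d ^ p) * ?ind js t)" if "length js = p" for js
    \<comment> \<open>For \<open>a = []\<close> the relation \<open>agree_off\<close> is trivial, so
      the indicator of having the path is \<open>path_local\<close>.\<close>
    by (intro path_span_cmult path_span.path_local[OF that, of "[]"]) (simp add: path_local_def)
  then have "path_span d p (\<lambda>t. \<Sum>js\<in>?W. (1 / real d ^ p) * ?ind js t)"
    by (intro path_span_sum) auto
  then show ?thesis by (rule path_span.cong) (simp add: eq)
qed

text \<open>The search has failed through child \<open>i\<close> and then tries the siblings one by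
  one. Telescoping writes \<open>1 - E_j * Q\<close> as \<open>(1 - Q) + Q * (1 - E_j)\<close>,
  where \<open>Q\<close> is the product over \<open>J\<close>. The weight of the new summand does
  not involve child \<open>j\<close>, so \<open>f\<close> may be arbitrary.\<close>

lemma path_span_siblings:
  assumes E: "path_span d p (\<lambda>t. 1 - E t)" and "finite J" "J \<subseteq> {..<d}" "i \<notin> J"
  shows "path_span d p (\<lambda>t. if kids t = [] then 0
    else f (child t i) * (1 - (\<Prod>j\<in>J. E (child t j))))"
  using assms(2-)
proof (induction J rule: finite_induct)
  case empty
  then show ?case by (intro path_span.cong[OF path_span.zero]) simp
next
  case (insert j J)
  have "path_span d p (\<lambda>t. if j < length (kids t)
      then f (child t i) * (\<Prod>j\<in>J. E (child t j)) * (1 - E (child t j)) else 0)"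
  proof (rule path_span_child[OF E])
    fix t t' :: ptree assume *: "\<And>i. i \<noteq> j \<Longrightarrow> child t i = child t' i"
    have "child t j' = child t' j'" if "j' \<in> J" for j' using insert that by (intro *) auto
    moreover have "child t i = child t' i" using insert by (intro *) auto
    ultimately show "f (child t i) * (\<Prod>j\<in>J. E (child t j)) = f (child t' i) * (\<Prod>j\<in>J. E (child t' j))"
      by simp
  qed
  then have "path_span d p (\<lambda>t. (if kids t = [] then 0
      else f (child t i) * (1 - (\<Prod>j\<in>J. E (child t j)))) +
    (if j < length (kids t)
      then f (child t i) * (\<Prod>j\<in>J. E (child t j)) * (1 - E (child t j)) else 0))"
    using insert by (intro path_span.add) auto
  then show ?case
  proof (rule path_span.cong)
    fix t assume "dcat d t"
    then have "kids t \<noteq> [] \<Longrightarrow> j < length (kids t)" using dcat_length_kids[of d t] insert by auto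
    then show "(if kids t = [] then 0 else f (child t i) * (1 - (\<Prod>j\<in>J. E (child t j)))) +
      (if j < length (kids t)
        then f (child t i) * (\<Prod>j\<in>J. E (child t j)) * (1 - E (child t j)) else 0) =
      (if kids t = [] then 0 else f (child t i) * (1 - (\<Prod>j\<in>insert j J. E (child t j))))"
      using insert by (auto simp: algebra_simps)
  qed
qed

text \<open>Success means either that the root path is long enough, or that it is too short and some
  hanging subtree succeeds. The second event has probability
  \<open>spine_fail d (\<lambda>_. 1) p t - spine_fail d E p t\<close>.\<close>

lemma path_span_spine_fail:
  assumes E: "path_span d p (\<lambda>t. 1 - E t)"
  shows "path_span d p (\<lambda>t. 1 - spine_fail d E p t)"
proof -
  have "path_span d p (\<lambda>t. spine_fail d (\<lambda>_. 1) r t - spine_fail d E r t)" for r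
  proof (induction r)
    case 0
    then show ?case by (simp add: path_span.zero)
  next
    case (Suc r)
    let ?D = "\<lambda>t. spine_fail d (\<lambda>_. 1) r t - spine_fail d E r t"
    \<comment> \<open>Given preferred child \<open>i\<close>, success occurs in a subtree hanging
      off the path below \<open>i\<close>, or that fails and a sibling of \<open>i\<close>
      succeeds.\<close>
    let ?g = "\<lambda>i t. (if i < length (kids t) then 1 * ?D (child t i) else 0) +
      (if kids t = [] then 0
        else spine_fail d E r (child t i) * (1 - (\<Prod>j\<in>{..<d} - {i}. E (child t j))))"
    have "path_span d p (\<lambda>t. (1 / real d) * (\<Sum>i<d. ?g i t))"
      by (intro path_span_cmult path_span_sum path_span.add path_span_siblings[OF E]
          path_span_child[OF Suc.IH]) auto
    then show ?case
    proof (rule path_span.cong)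
      fix t assume t: "dcat d t"
      show "(1 / real d) * (\<Sum>i<d. ?g i t) =
        spine_fail d (\<lambda>_. 1) (Suc r) t - spine_fail d E (Suc r) t"
      proof (cases "kids t = []")
        case True
        then show ?thesis by simp
      next
        case False
        then have "length (kids t) = d" using dcat_length_kids[OF t] by simp
        then have "?g i t = spine_fail d (\<lambda>_. 1) r (child t i) -
            spine_fail d E r (child t i) * (\<Prod>j\<in>{..<d} - {i}. E (child t j))" if "i < d" for i
          using that False by (simp add: algebra_simps)
        then have "(\<Sum>i<d. ?g i t) = (\<Sum>i<d. spine_fail d (\<lambda>_. 1) r (child t i) -
            spine_fail d E r (child t i) * (\<Prod>j\<in>{..<d} - {i}. E (child t j)))"
          by (intro sum.cong) auto
        then show ?thesis using False by (simp add: sum_subtractf diff_divide_distrib)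
      qed
    qed
  qed
  from path_span.add[OF path_span_root_path this[of p]] show ?thesis
    by (rule path_span.cong) simp
qed

lemma path_span_search_fail: "path_span d p (\<lambda>t. 1 - search_fail d p n t)"
  by (induction n) (auto simp: path_span.zero intro: path_span_spine_fail)

section \<open>Packing disjoint paths\<close>

lemma spine_fail_nonneg: "(\<And>t. E t \<ge> 0) \<Longrightarrow> spine_fail d E r t \<ge> 0"
  by (induction r arbitrary: t) (auto intro!: divide_nonneg_nonneg sum_nonneg mult_nonneg_nonneg prod_nonneg)

lemma search_fail_nonneg: "search_fail d p n t \<ge> 0"
  by (induction n arbitrary: t) (auto intro: spine_fail_nonneg)

text \<open>The number of internal vertices of the complete \<open>d\<close>-ary tree of height
  \<open>h\<close>.\<close>

fun full_size :: "nat \<Rightarrow> nat \<Rightarrow> nat" where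
  "full_size d 0 = 0"
| "full_size d (Suc h) = 1 + d * full_size d h"

lemma full_size_mono:
  assumes "d \<ge> 1" "h \<le> h'"
  shows "full_size d h \<le> full_size d h'"
proof -
  have "full_size d n \<le> full_size d (Suc n)" for n
    using assms(1) by (cases d) auto
  then show ?thesis using assms(2) by (rule lift_Suc_mono_le)
qed

text \<open>Cutting off, from the leaves upwards, every subtree that has reached height \<open>p\<close> yields \<open>N\<close>
disjoint paths of length \<open>p\<close> and leaves a component of height \<open>h < p\<close> at the root.  The last factor
accounts for the possibility that a preferred path entering at the root is completed inside this
component.\<close>

lemma spine_fail_bound:
  assumes "d \<ge> 2" "p \<ge> 1" "dcat d t"
  shows "\<exists>N h. h < p \<and> internal t \<le> full_size d p * N + full_size d h \<and>
    (\<forall>n\<ge>internal t. \<forall>r\<le>p. spine_fail d (search_fail d p n) r t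
      \<le> (1 - 1 / real d ^ p) ^ N * (if r \<le> h then 1 - 1 / real d ^ r else 1))"
  using assms(3)
proof (induction t)
  case (Node ts)
  \<comment> \<open>The probability that one given path of length \<open>p\<close> is not
    preferred.\<close>
  define \<theta> where "\<theta> = 1 - 1 / real d ^ p"
  define M where "M = full_size d p"
  have \<theta>: "0 \<le> \<theta>" "\<theta> \<le> 1" using assms(1) by (auto simp: \<theta>_def)
  let ?b = "\<lambda>r h. if r \<le> h then 1 - 1 / real d ^ r else 1 :: real"
  let ?F = "\<lambda>n r t. spine_fail d (search_fail d p n) r t"
  show ?case
  proof (cases "ts = []")
    case True
    have "?F n r (Node ts) \<le> \<theta> ^ 0 * ?b r 0" for n r
      using True by (cases r) auto
    then show ?thesis using True assms(2) unfolding \<theta>_def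
      by (intro exI[of _ 0]) auto
  next
    case False
    then have len: "length ts = d" using Node.prems by simp
    have "\<forall>i<d. \<exists>N h. h < p \<and> internal (ts ! i) \<le> M * N + full_size d h \<and>
      (\<forall>n\<ge>internal (ts ! i). \<forall>r\<le>p. ?F n r (ts ! i) \<le> \<theta> ^ N * ?b r h)"
      using Node len unfolding \<theta>_def M_def by auto
    then obtain N h where Nh: "\<And>i. i < d \<Longrightarrow> h i < p"
        "\<And>i. i < d \<Longrightarrow> internal (ts ! i) \<le> M * N i + full_size d (h i)"
        "\<And>i n r. i < d \<Longrightarrow> internal (ts ! i) \<le> n \<Longrightarrow> r \<le> p \<Longrightarrow>
          ?F n r (ts ! i) \<le> \<theta> ^ N i * ?b r (h i)"
      by metis
    \<comment> \<open>The paths cut off below the children add up, and the component left at the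
      root has height one more than the highest component left at a child.\<close>
    define N' where "N' = (\<Sum>i<d. N i)"
    define m where "m = Max (h ` {..<d})"
    have d0: "{..<d} \<noteq> {}" using assms(1) by (simp add: lessThan_empty_iff)
    have m_ge: "h i \<le> m" if "i < d" for i unfolding m_def using that by auto
    have "m \<in> h ` {..<d}" unfolding m_def using d0 by (intro Max_in) auto
    then obtain i0 where i0: "i0 < d" "h i0 = m" by auto
    have m_p: "Suc m \<le> p" using Nh(1)[OF i0(1)] i0(2) by simp
    have int: "internal (Node ts) = 1 + (\<Sum>i<d. internal (ts ! i))"
      using False len by (simp add: sum_list_sum_nth atLeast0LessThan)
    have "(\<Sum>i<d. internal (ts ! i)) \<le> (\<Sum>i<d. M * N i + full_size d m)"
      using Nh(2) m_ge full_size_mono[of d] assms(1)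
      by (intro sum_mono) (meson add_left_mono lessThan_iff order_trans le_trans one_le_numeral)
    then have size: "internal (Node ts) \<le> M * N' + full_size d (Suc m)"
      unfolding int N'_def by (simp add: sum.distrib sum_distrib_left)
    have bound: "?F n r (Node ts) \<le> \<theta> ^ N' * ?b r (Suc m)"
      if n: "n \<ge> internal (Node ts)" and r: "r \<le> p" for n r
    proof (cases r)
      case 0
      then show ?thesis by simp
    next
      case (Suc s)
      have n_i: "internal (ts ! i) \<le> n - 1" "internal (ts ! i) \<le> n" if "i < d" for i
        using n int member_le_sum[of i "{..<d}" "\<lambda>i. internal (ts ! i)"] that by auto
      have n_Suc: "n = Suc (n - 1)" using n int by simp
      \<comment> \<open>A hanging subtree starts a fresh preferred path with
        \<open>r = p > h j\<close>, so the last factor is 1. The cutoff drops to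
        \<open>n - 1\<close>, still at least \<open>internal (ts ! j)\<close>.\<close>
      have hang: "search_fail d p n (ts ! j) \<le> \<theta> ^ N j" if "j < d" for j
      proof -
        have "search_fail d p n (ts ! j) = ?F (n - 1) p (ts ! j)" by (subst n_Suc) simp
        also have "\<dots> \<le> \<theta> ^ N j"
          using Nh(3)[OF that n_i(1)[OF that] order_refl] Nh(1)[OF that] by simp
        finally show ?thesis .
      qed
      have summand: "?F n s (ts ! i) * (\<Prod>j\<in>{..<d} - {i}. search_fail d p n (ts ! j))
          \<le> \<theta> ^ N' * ?b s (h i)" if i: "i < d" for i
      proof -
        have "?F n s (ts ! i) * (\<Prod>j\<in>{..<d} - {i}. search_fail d p n (ts ! j))
            \<le> (\<theta> ^ N i * ?b s (h i)) * (\<Prod>j\<in>{..<d} - {i}. \<theta> ^ N j)"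
        proof (intro mult_mono prod_mono conjI)
          show "?F n s (ts ! i) \<le> \<theta> ^ N i * ?b s (h i)" using Nh(3) i n_i(2) r Suc by simp
          show "0 \<le> \<theta> ^ N i * ?b s (h i)" using \<theta> assms(1) by auto
        qed (auto intro: prod_nonneg search_fail_nonneg hang)
        also have "\<dots> = \<theta> ^ N' * ?b s (h i)"
          using i unfolding N'_def power_sum by (simp add: prod.remove[of "{..<d}" i])
        finally show ?thesis .
      qed
      have "?F n r (Node ts) =
          (\<Sum>i<d. ?F n s (ts ! i) * (\<Prod>j\<in>{..<d} - {i}. search_fail d p n (ts ! j))) / real d"
        using False len Suc by (simp add: child_def)
      also have "\<dots> \<le> (\<Sum>i<d. \<theta> ^ N' * ?b s (h i)) / real d"
        by (intro divide_right_mono sum_mono summand) auto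
      also have "\<dots> = \<theta> ^ N' * ((\<Sum>i<d. ?b s (h i)) / real d)"
        by (simp add: sum_distrib_left)
      also have "\<dots> \<le> \<theta> ^ N' * ?b r (Suc m)"
      proof (rule mult_left_mono)
        have le1: "?b s (h i) \<le> 1" for i by simp
        \<comment> \<open>Only the child \<open>i0\<close> of maximal remaining height keeps its
          gain. Averaging with \<open>d - 1\<close> ones turns \<open>1 - 1 / d ^ s\<close> into
          \<open>1 - 1 / d ^ Suc s\<close>.\<close>
        have "(\<Sum>i<d. ?b s (h i)) = ?b s m + (\<Sum>i\<in>{..<d} - {i0}. ?b s (h i))"
          using i0 by (simp add: sum.remove[of "{..<d}" i0])
        also have "\<dots> \<le> ?b s m + (\<Sum>i\<in>{..<d} - {i0}. 1)"
          by (intro add_left_mono sum_mono le1)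
        also have "\<dots> = ?b s m + (real d - 1)" using i0 by (simp add: of_nat_diff)
        finally have "(\<Sum>i<d. ?b s (h i)) / real d \<le> (?b s m + (real d - 1)) / real d"
          by (rule divide_right_mono) simp
        also have "\<dots> = ?b r (Suc m)" using assms(1) Suc by (auto simp: field_simps)
        finally show "(\<Sum>i<d. ?b s (h i)) / real d \<le> ?b r (Suc m)" .
      qed (use \<theta> in simp)
      finally show ?thesis .
    qed
    show ?thesis
    proof (cases "Suc m = p")
      case False
      then show ?thesis using m_p size bound unfolding M_def \<theta>_def
        by (intro exI[of _ N'] exI[of _ "Suc m"]) auto
    next
      \<comment> \<open>The root component has reached height \<open>p\<close>: it is cut off as one
        more path and the remaining height restarts at 0.\<close>
      case True
      have "?F n r (Node ts) \<le> \<theta> ^ Suc N' * ?b r 0"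
        if "n \<ge> internal (Node ts)" "r \<le> p" for n r
      proof (cases r)
        case 0
        then show ?thesis by simp
      next
        case (Suc s)
        have "?F n r (Node ts) \<le> \<theta> ^ N' * (1 - 1 / real d ^ r)"
          using bound[OF that] that True by simp
        \<comment> \<open>As \<open>r \<le> p\<close>, finding \<open>r\<close> preferred edges is
          at least as likely as finding \<open>p\<close>.\<close>
        also have "\<dots> \<le> \<theta> ^ N' * \<theta>"
          using \<theta> that assms(1) unfolding \<theta>_def
          by (intro mult_left_mono diff_left_mono divide_left_mono power_increasing) auto
        also have "\<dots> = \<theta> ^ Suc N' * ?b r 0" using Suc by simp
        finally show ?thesis .
      qed
      moreover have "internal (Node ts) \<le> M * Suc N' + full_size d 0"
        using size True unfolding M_def by simp
      ultimately show ?thesis using assms(2) unfolding M_def \<theta>_def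
        by (intro exI[of _ "Suc N'"] exI[of _ 0]) auto
    qed
  qed
qed

text \<open>The packing gives \<open>k \<le> M * (N + 1)\<close>, so \<open>\<theta> ^ N\<close>
  decays at rate \<open>- ln \<theta> / M\<close>; the spare \<open>1\<close> costs the factor
  \<open>1 / \<theta>\<close>.\<close>

lemma search_fail_exp_bound:
  assumes "d \<ge> 2"
  shows "\<exists>C c. C > 0 \<and> c > 0 \<and>
    (\<forall>k. \<forall>t\<in>Cat d k. search_fail d p (Suc k) t \<le> C * exp (- c * real k))"
proof (cases "p = 0")
  \<comment> \<open>For \<open>p = 0\<close> the search succeeds at once, so the failure probability
    is 0.\<close>
  case True
  then show ?thesis by (intro exI[of _ 1]) simp
next
  case False
  define \<theta> where "\<theta> = 1 - 1 / real d ^ p"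
  define M where "M = full_size d p"
  have "real d ^ p > 1" using assms False by (intro one_less_power) auto
  then have \<theta>: "0 < \<theta>" "\<theta> < 1" using assms by (auto simp: \<theta>_def divide_less_eq_1)
  have M: "M > 0" using False unfolding M_def by (cases p) auto
  define c where "c = - ln \<theta> / real M"
  have c: "c > 0" using \<theta> M by (simp add: c_def divide_neg_pos)
  have "search_fail d p (Suc k) t \<le> 1 / \<theta> * exp (- c * real k)" if t: "t \<in> Cat d k" for k t
  proof -
    obtain N h where Nh: "h < p" "internal t \<le> M * N + full_size d h"
        "\<forall>n\<ge>internal t. \<forall>r\<le>p. spine_fail d (search_fail d p n) r t
          \<le> \<theta> ^ N * (if r \<le> h then 1 - 1 / real d ^ r else 1)"
      using spine_fail_bound[of d p t] assms False t unfolding \<theta>_def M_def Cat_def by auto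
    have "full_size d h \<le> M" using Nh(1) assms unfolding M_def by (intro full_size_mono) auto
    then have "k \<le> M * (N + 1)" using Nh(2) t by (simp add: Cat_def)
    then have "real k \<le> real M * (real N + 1)" by (metis of_nat_1 of_nat_add of_nat_le_iff of_nat_mult)
    then have "c * real k \<le> c * (real M * (real N + 1))" using c by (intro mult_left_mono) auto
    also have "\<dots> = - (real N + 1) * ln \<theta>" using M by (simp add: c_def field_simps)
    finally have le: "real N * ln \<theta> \<le> - ln \<theta> + - c * real k" by (simp add: algebra_simps)
    have "search_fail d p (Suc k) t \<le> \<theta> ^ N"
      using Nh(3)[rule_format, of k p] Nh(1) t by (simp add: Cat_def)
    also have "\<theta> ^ N = exp (real N * ln \<theta>)" using \<theta> by (simp add: exp_of_nat_mult)
    also have "\<dots> \<le> exp (- ln \<theta> + - c * real k)" using le by simp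
    also have "\<dots> = 1 / \<theta> * exp (- c * real k)"
      using \<theta> by (simp only: exp_add exp_minus exp_ln) (simp add: field_simps)
    finally show ?thesis .
  qed
  then show ?thesis using c \<theta> by (intro exI[of _ "1 / \<theta>"] exI[of _ c]) auto
qed

section \<open>From the exponential bound to the two norms\<close>

lemma Cat_nonempty:
  assumes "d \<ge> 1"
  shows "Cat d k \<noteq> {}"
proof (induction k)
  case 0
  have "Node [] \<in> Cat d 0" by (simp add: Cat_def)
  then show ?case by blast
next
  case (Suc k)
  then obtain t where "t \<in> Cat d k" by blast
  then have "Node (t # replicate (d - 1) (Node [])) \<in> Cat d (Suc k)"
    using assms by (auto simp: Cat_def map_replicate sum_list_replicate)
  then show ?case by blast
qed

lemma ln_squared_le: "x \<ge> 1 \<Longrightarrow> (ln x)\<^sup>2 \<le> 4 * (x :: real)"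
proof -
  assume x: "x \<ge> 1"
  have "ln x = 2 * ln (sqrt x)" using x by (simp add: ln_sqrt)
  also have "\<dots> \<le> 2 * sqrt x" using x ln_le_minus_one[of "sqrt x"] by simp
  finally have "(ln x)\<^sup>2 \<le> (2 * sqrt x)\<^sup>2" using x by (intro power_mono) auto
  then show ?thesis using x by (simp add: power_mult_distrib)
qed

theorem theorem1p8:
  fixes p d :: nat
  assumes "d \<ge> 2"
  shows "\<exists>C c C' c' :: real. C > 0 \<and> c > 0 \<and> C' > 0 \<and> c' > 0 \<and>
    (\<exists>K. \<forall>k\<ge>K. \<exists>\<phi> :: ptree \<Rightarrow> real.
       in_shuffle_span d k p \<phi> \<and>
       (1 / real (card (Cat d k))) * (\<Sum>T\<in>Cat d k. \<bar>\<phi> T - 1\<bar>) \<le> C * exp (- c * real k) \<and>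
       (SUP T\<in>Cat d k. \<bar>\<phi> T - 1\<bar>) \<le> C' * exp (- c' * (ln (real k))\<^sup>2))"
proof -
  obtain C c where C: "C > 0" "c > 0"
      "\<And>k t. t \<in> Cat d k \<Longrightarrow> search_fail d p (Suc k) t \<le> C * exp (- c * real k)"
    using search_fail_exp_bound[OF assms] by metis
  have d: "d \<ge> 1" using assms by simp
  have "\<exists>\<phi>. in_shuffle_span d k p \<phi> \<and>
       (1 / real (card (Cat d k))) * (\<Sum>T\<in>Cat d k. \<bar>\<phi> T - 1\<bar>) \<le> C * exp (- c * real k) \<and>
       (SUP T\<in>Cat d k. \<bar>\<phi> T - 1\<bar>) \<le> C * exp (- (c / 4) * (ln (real k))\<^sup>2)" if k: "k \<ge> 1" for k
  proof (intro exI conjI)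
    let ?\<phi> = "\<lambda>t. 1 - search_fail d p (Suc k) t"
    show "in_shuffle_span d k p ?\<phi>"
      by (rule in_shuffle_span_path_span[OF d path_span_search_fail])
    have le: "\<bar>?\<phi> t - 1\<bar> \<le> C * exp (- c * real k)" if "t \<in> Cat d k" for t
      using C(3)[OF that] search_fail_nonneg[of d p "Suc k" t] by simp
    have card: "card (Cat d k) > 0" using finite_Cat[OF d] Cat_nonempty[OF d] by (simp add: card_gt_0_iff)
    have "(\<Sum>T\<in>Cat d k. \<bar>?\<phi> T - 1\<bar>) \<le> real (card (Cat d k)) * (C * exp (- c * real k))"
      using le by (rule sum_bounded_above)
    then show "(1 / real (card (Cat d k))) * (\<Sum>T\<in>Cat d k. \<bar>?\<phi> T - 1\<bar>) \<le> C * exp (- c * real k)"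
      using card by (simp add: field_simps)
    \<comment> \<open>The pointwise bound is already exponential in \<open>k\<close>; dividing the
      rate by 4 absorbs the constant in \<open>ln_squared_le\<close>.\<close>
    have "c / 4 * (ln (real k))\<^sup>2 \<le> c / 4 * (4 * real k)"
      using k C(2) by (intro mult_left_mono ln_squared_le) auto
    then have "C * exp (- c * real k) \<le> C * exp (- (c / 4) * (ln (real k))\<^sup>2)"
      using C(1) by simp
    then show "(SUP T\<in>Cat d k. \<bar>?\<phi> T - 1\<bar>) \<le> C * exp (- (c / 4) * (ln (real k))\<^sup>2)"
      using le Cat_nonempty[OF d] by (intro cSUP_least) (auto intro: order_trans)
  qed
  then show ?thesis using C(1,2)
    by (intro exI[of _ C] exI[of _ c] exI[of _ C] exI[of _ "c / 4"] conjI exI[of _ "1 :: nat"]) auto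
qed

end
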